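(* Let $(A,\rhd,\lhd)$ be a dialgebra and $\mathfrak{B}$ be a nondegenerate bilinear form on $A$. Let $\varphi_{\mathfrak{B}}:A\to A^*$ be the linear isomorphism defined by $\langle\varphi_{\mathfrak{B}}(x),y\rangle=\mathfrak{B}(x,y)$, and let $r_{\mathfrak{B}}\in A\otimes A$ be the 2-tensor form of $\varphi_{\mathfrak{B}}^{-1}$, that is, $\langle r_{\mathfrak{B}},a^*\otimes b^*\rangle=\langle\varphi_{\mathfrak{B}}^{-1}(a^* ),b^*\rangle$ for all $a^*,b^*\in A^*$. Then $(A,\rhd,\lhd,\mathfrak{B})$ is a skew-symmetric Frobenius dialgebra if and only if $r_{\mathfrak{B}}$ is skew-symmetric and invariant.
   Context: All vector spaces and algebras are finite-dimensional over a field $\mathbb F$ of characteristic $0$; algebras are not assumed unital. A dialgebra is a triple $(A,\rhd,\lhd)$ where $\rhd,\lhd$ are associative bilinear products on a vector space $A$ such that for all $x,y,z\in A$: $(x\lhd y)\lhd z=x\lhd(y\rhd z)$, $(x\rhd y)\lhd z=x\rhd(y\lhd z)$, $(x\lhd y)\rhd z=x\rhd(y\rhd z)$. A bilinear form $\mathfrak{B}$ on a dialgebra is invariant if $\mathfrak{B}(x\rhd y,z)=\mathfrak{B}(x,y\rhd z-y\lhd z)$ and $\mathfrak{B}(x\lhd y,z)=\mathfrak{B}(x,y\rhd z)$. A skew-symmetric Frobenius dialgebra is a dialgebra equipped with a nondegenerate skew-symmetric invariant bilinear form. Put $x\star y=x\rhd y-x\lhd y$ and $L_\diamond(x)y=x\diamond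 y=R_\diamond(y)x$. An element $r\in A\otimes A$ is called invariant if $E(x)r=F(x)r=0$ for all $x\in A$, where $E(x)=R_{\star}(x)\otimes\mathrm{id}+\mathrm{id}\otimes L_{\lhd}(x)$ and $F(x)=R_{\rhd}(x)\otimes\mathrm{id}-\mathrm{id}\otimes L_{\star}(x)$. An element $r\in A\otimes A$ is skew-symmetric if $\tau(r)=-r$, where $\tau(x\otimes y)=y\otimes x$. *)

theory Defs
  imports Complex_Main "HOL-Library.Poly_Mapping"
begin

section \<open>The tensor square of a vector space\<close>

text \<open>
  For a vector space \<open>V\<close> over \<open>F\<close>, given as a type with a scalar multiplication \<open>scale\<close>,
  the tensor product \<open>V \<otimes> V\<close> is the quotient of the free vector space on \<open>V \<times> V\<close> by the
  bilinearity relations. As the subspace of relations depends on \<open>scale\<close>, the quotient is not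
  a type but the set \<open>tensor_space\<close> of equivalence classes, each of which is a set of
  formal linear combinations.
\<close>

abbreviation free_scale :: "'f::field \<Rightarrow> ('k \<Rightarrow>\<^sub>0 'f) \<Rightarrow> ('k \<Rightarrow>\<^sub>0 'f)"
  where "free_scale c \<equiv> Poly_Mapping.map ((*) c)"

lemma lookup_free_scale [simp]: "Poly_Mapping.lookup (free_scale c p) k = c * Poly_Mapping.lookup p k"
  by transfer (auto simp: when_def)

lemma vector_space_free_scale: "vector_space (free_scale :: 'f::field \<Rightarrow> ('k \<Rightarrow>\<^sub>0 'f) \<Rightarrow> _)"
  by unfold_locales (auto intro!: poly_mapping_eqI simp: lookup_add algebra_simps)

interpretation free: vector_space "free_scale :: 'f::field \<Rightarrow> ('k \<Rightarrow>\<^sub>0 'f) \<Rightarrow> _"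
  by (rule vector_space_free_scale)

definition free_map :: "('k \<Rightarrow> 'l) \<Rightarrow> ('k \<Rightarrow>\<^sub>0 'f::field) \<Rightarrow> ('l \<Rightarrow>\<^sub>0 'f)"
  where "free_map h p = (\<Sum>k\<in>Poly_Mapping.keys p. Poly_Mapping.single (h k) (Poly_Mapping.lookup p k))"

definition free_eval :: "('k \<Rightarrow> 'f) \<Rightarrow> ('k \<Rightarrow>\<^sub>0 'f::field) \<Rightarrow> 'f"
  where "free_eval h p = (\<Sum>k\<in>Poly_Mapping.keys p. Poly_Mapping.lookup p k * h k)"

lemma free_map_single [simp]:
  "free_map h (Poly_Mapping.single k c) = Poly_Mapping.single (h k) c"
  by (cases "c = 0") (simp_all add: free_map_def)

lemma free_eval_single [simp]: "free_eval h (Poly_Mapping.single k c) = c * h k"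
  by (cases "c = 0") (simp_all add: free_eval_def)

lemma free_map_add: "free_map h (p + q) = free_map h p + free_map h q"
  unfolding free_map_def
  by (rule setsum_keys_plus_distrib) (simp_all add: single_add)

lemma free_eval_add: "free_eval h (p + q) = free_eval h p + free_eval h q"
  unfolding free_eval_def
  by (rule setsum_keys_plus_distrib) (simp_all add: algebra_simps)

lemma free_map_scale: "free_map h (free_scale c p) = free_scale c (free_map h p)"
proof (cases "c = 0")
  case True
  then show ?thesis by (simp add: free_map_def)
next
  case False
  then have "Poly_Mapping.keys (free_scale c p) = Poly_Mapping.keys p"
    by (auto simp: in_keys_iff)
  moreover have "Poly_Mapping.single k (c * d) = free_scale c (Poly_Mapping.single k d)" for k and d
    by (rule poly_mapping_eqI) (simp add: lookup_single when_def)
  ultimately show ?thesis by (simp add: free_map_def free.scale_sum_right)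
qed

lemma free_eval_scale: "free_eval h (free_scale c p) = c * free_eval h p"
proof (cases "c = 0")
  case False
  then have "Poly_Mapping.keys (free_scale c p) = Poly_Mapping.keys p"
    by (auto simp: in_keys_iff)
  then show ?thesis by (simp add: free_eval_def sum_distrib_left mult.assoc)
qed (simp add: free_eval_def)

lemma linear_free_map: "Vector_Spaces.linear free_scale free_scale (free_map h)"
  by unfold_locales
    (auto simp: free_map_add free_map_scale free.scale_right_distrib free.scale_left_distrib)

lemma linear_free_eval: "Vector_Spaces.linear free_scale (*) (free_eval h)"
  by unfold_locales (auto simp: free_eval_add free_eval_scale algebra_simps)

locale tensor_square = vector_space scale
  for scale :: "'a::field \<Rightarrow> 'b::ab_group_add \<Rightarrow> 'b" (infixr \<open>*s\<close> 75)
begin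

definition tensor_relations :: "('b \<times> 'b \<Rightarrow>\<^sub>0 'a) set" where
  "tensor_relations =
     {Poly_Mapping.single (x + y, z) 1 - Poly_Mapping.single (x, z) 1
        - Poly_Mapping.single (y, z) 1 | x y z. True}
   \<union> {Poly_Mapping.single (x, y + z) 1 - Poly_Mapping.single (x, y) 1
        - Poly_Mapping.single (x, z) 1 | x y z. True}
   \<union> {Poly_Mapping.single (c *s x, y) 1 - Poly_Mapping.single (x, y) c | c x y. True}
   \<union> {Poly_Mapping.single (x, c *s y) 1 - Poly_Mapping.single (x, y) c | c x y. True}"

definition tensor_rel :: "(('b \<times> 'b \<Rightarrow>\<^sub>0 'a) \<times> ('b \<times> 'b \<Rightarrow>\<^sub>0 'a)) set"
  where "tensor_rel = {(p, q). p - q \<in> module.span free_scale tensor_relations}"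

definition tensor_class :: "('b \<times> 'b \<Rightarrow>\<^sub>0 'a) \<Rightarrow> ('b \<times> 'b \<Rightarrow>\<^sub>0 'a) set"
  where "tensor_class p = tensor_rel `` {p}"

definition tensor_space :: "('b \<times> 'b \<Rightarrow>\<^sub>0 'a) set set"
  where "tensor_space = UNIV // tensor_rel"

definition tensor_zero :: "('b \<times> 'b \<Rightarrow>\<^sub>0 'a) set"
  where "tensor_zero = tensor_class 0"

definition tensor_add ::
    "('b \<times> 'b \<Rightarrow>\<^sub>0 'a) set \<Rightarrow> ('b \<times> 'b \<Rightarrow>\<^sub>0 'a) set \<Rightarrow> ('b \<times> 'b \<Rightarrow>\<^sub>0 'a) set"
  where "tensor_add r s = (\<Union>p\<in>r. \<Union>q\<in>s. tensor_class (p + q))"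

definition tensor_diff ::
    "('b \<times> 'b \<Rightarrow>\<^sub>0 'a) set \<Rightarrow> ('b \<times> 'b \<Rightarrow>\<^sub>0 'a) set \<Rightarrow> ('b \<times> 'b \<Rightarrow>\<^sub>0 'a) set"
  where "tensor_diff r s = (\<Union>p\<in>r. \<Union>q\<in>s. tensor_class (p - q))"

definition tensor_uminus :: "('b \<times> 'b \<Rightarrow>\<^sub>0 'a) set \<Rightarrow> ('b \<times> 'b \<Rightarrow>\<^sub>0 'a) set"
  where "tensor_uminus r = (\<Union>p\<in>r. tensor_class (- p))"

text \<open>\<open>f \<otimes> g\<close>, for linear endomorphisms \<open>f\<close> and \<open>g\<close>, and the flip \<open>\<tau>\<close>.\<close>

definition tensor_map ::
    "('b \<Rightarrow> 'b) \<Rightarrow> ('b \<Rightarrow> 'b) \<Rightarrow> ('b \<times> 'b \<Rightarrow>\<^sub>0 'a) set \<Rightarrow> ('b \<times> 'b \<Rightarrow>\<^sub>0 'a) set"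
  where "tensor_map f g r = (\<Union>p\<in>r. tensor_class (free_map (map_prod f g) p))"

definition tensor_flip :: "('b \<times> 'b \<Rightarrow>\<^sub>0 'a) set \<Rightarrow> ('b \<times> 'b \<Rightarrow>\<^sub>0 'a) set"
  where "tensor_flip r = (\<Union>p\<in>r. tensor_class (free_map prod.swap p))"

definition dual_space :: "('b \<Rightarrow> 'a) set"
  where "dual_space = {a. Vector_Spaces.linear scale (*) a}"

text \<open>
  The pairing \<open>\<langle>r, a \<otimes> b\<rangle>\<close> for \<open>a\<close>, \<open>b\<close> in the dual space. The values of the
  representatives of \<open>r\<close> all coincide.
\<close>

definition tensor_pairing ::
    "('b \<times> 'b \<Rightarrow>\<^sub>0 'a) set \<Rightarrow> ('b \<Rightarrow> 'a) \<Rightarrow> ('b \<Rightarrow> 'a) \<Rightarrow> 'a"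
  where "tensor_pairing r a b = the_elem (free_eval (\<lambda>(x, y). a x * b y) ` r)"

definition skew_symmetric_tensor :: "('b \<times> 'b \<Rightarrow>\<^sub>0 'a) set \<Rightarrow> bool"
  where "skew_symmetric_tensor r \<longleftrightarrow> tensor_flip r = tensor_uminus r"

text \<open>The operations above do not depend on the choice of representatives.\<close>

lemma equiv_tensor_rel: "equiv UNIV tensor_rel"
proof (rule equivI)
  show "refl tensor_rel"
    by (auto simp: refl_on_def tensor_rel_def free.span_zero)
  show "sym tensor_rel"
    unfolding sym_def tensor_rel_def using free.span_neg by fastforce
  show "trans tensor_rel"
    unfolding trans_def tensor_rel_def using free.span_add by fastforce
qed auto

lemma tensor_class_eq_iff:
  "tensor_class p = tensor_class q \<longleftrightarrow> p - q \<in> module.span free_scale tensor_relations"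
  using eq_equiv_class_iff[OF equiv_tensor_rel, of p q]
  by (simp add: tensor_class_def tensor_rel_def)

lemma UN_tensor_class:
  assumes "\<And>p q. p - q \<in> module.span free_scale tensor_relations
             \<Longrightarrow> f p - f q \<in> module.span free_scale tensor_relations"
  shows "(\<Union>p\<in>tensor_class p0. tensor_class (f p)) = tensor_class (f p0)"
proof -
  have "congruent tensor_rel (\<lambda>p. tensor_class (f p))"
    by (rule congruentI) (auto simp: tensor_rel_def tensor_class_eq_iff assms)
  then show ?thesis
    using UN_equiv_class[OF equiv_tensor_rel, of "\<lambda>p. tensor_class (f p)" p0]
    by (simp add: tensor_class_def)
qed

lemma tensor_uminus_class: "tensor_uminus (tensor_class p) = tensor_class (- p)"
  unfolding tensor_uminus_def
proof (rule UN_tensor_class)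
  fix p q :: "'b \<times> 'b \<Rightarrow>\<^sub>0 'a"
  assume "p - q \<in> free.span tensor_relations"
  from free.span_neg[OF this] show "- p - - q \<in> free.span tensor_relations" by simp
qed

lemma tensor_add_class: "tensor_add (tensor_class p) (tensor_class q) = tensor_class (p + q)"
proof -
  have "(\<Union>q\<in>tensor_class q. tensor_class (p + q)) = tensor_class (p + q)" for p
    by (rule UN_tensor_class) simp
  moreover have "(\<Union>p\<in>tensor_class p. tensor_class (p + q)) = tensor_class (p + q)"
    by (rule UN_tensor_class) simp
  ultimately show ?thesis by (simp add: tensor_add_def)
qed

lemma tensor_diff_class: "tensor_diff (tensor_class p) (tensor_class q) = tensor_class (p - q)"
proof -
  have "(\<Union>q\<in>tensor_class q. tensor_class (p - q)) = tensor_class (p - q)" for p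
  proof (rule UN_tensor_class)
    fix q q' :: "'b \<times> 'b \<Rightarrow>\<^sub>0 'a"
    assume "q - q' \<in> free.span tensor_relations"
    from free.span_neg[OF this] show "p - q - (p - q') \<in> free.span tensor_relations" by simp
  qed
  moreover have "(\<Union>p\<in>tensor_class p. tensor_class (p - q)) = tensor_class (p - q)"
    by (rule UN_tensor_class) simp
  ultimately show ?thesis by (simp add: tensor_diff_def)
qed

lemma tensor_relationsI:
  "Poly_Mapping.single (x + y, z) 1 - Poly_Mapping.single (x, z) 1
     - Poly_Mapping.single (y, z) 1 \<in> tensor_relations"
  "Poly_Mapping.single (x, y + z) 1 - Poly_Mapping.single (x, y) 1
     - Poly_Mapping.single (x, z) 1 \<in> tensor_relations"
  "Poly_Mapping.single (c *s x, y) 1 - Poly_Mapping.single (x, y) c \<in> tensor_relations"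
  "Poly_Mapping.single (x, c *s y) 1 - Poly_Mapping.single (x, y) c \<in> tensor_relations"
  unfolding tensor_relations_def by blast+

lemma tensor_relationsE:
  assumes "d \<in> tensor_relations"
  obtains x y z where "d = Poly_Mapping.single (x + y, z) 1 - Poly_Mapping.single (x, z) 1
      - Poly_Mapping.single (y, z) 1"
    | x y z where "d = Poly_Mapping.single (x, y + z) 1 - Poly_Mapping.single (x, y) 1
      - Poly_Mapping.single (x, z) 1"
    | c x y where "d = Poly_Mapping.single (c *s x, y) 1 - Poly_Mapping.single (x, y) c"
    | c x y where "d = Poly_Mapping.single (x, c *s y) 1 - Poly_Mapping.single (x, y) c"
  using assms unfolding tensor_relations_def by blast

lemma free_map_span:
  assumes "free_map h ` tensor_relations \<subseteq> tensor_relations"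
    and "p - q \<in> free.span tensor_relations"
  shows "free_map h p - free_map h q \<in> free.span tensor_relations"
proof -
  interpret h: Vector_Spaces.linear free_scale free_scale "free_map h :: ('b \<times> 'b \<Rightarrow>\<^sub>0 'a) \<Rightarrow> _"
    by (rule linear_free_map)
  have "free_map h (p - q) \<in> free_map h ` free.span tensor_relations"
    using assms(2) by blast
  also have "\<dots> = free.span (free_map h ` tensor_relations)"
    by (rule h.span_image[symmetric])
  also have "\<dots> \<subseteq> free.span tensor_relations"
    by (rule free.span_mono[OF assms(1)])
  finally show ?thesis by (simp add: h.diff)
qed

lemma free_map_diff: "free_map h (p - q) = free_map h p - free_map h q"
  using free_map_add[of h "p - q" q] by (simp add: algebra_simps)

lemma free_eval_diff: "free_eval h (p - q) = free_eval h p - free_eval h q"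
  using free_eval_add[of h "p - q" q] by (simp add: algebra_simps)

lemma tensor_map_class:
  assumes "Vector_Spaces.linear scale scale f" and "Vector_Spaces.linear scale scale g"
  shows "tensor_map f g (tensor_class p) = tensor_class (free_map (map_prod f g) p)"
  unfolding tensor_map_def
proof (rule UN_tensor_class, rule free_map_span)
  interpret f: Vector_Spaces.linear scale scale f by fact
  interpret g: Vector_Spaces.linear scale scale g by fact
  show "free_map (map_prod f g) ` tensor_relations \<subseteq> tensor_relations"
  proof (rule image_subsetI)
    fix d :: "'b \<times> 'b \<Rightarrow>\<^sub>0 'a"
    assume "d \<in> tensor_relations"
    then show "free_map (map_prod f g) d \<in> tensor_relations"
      by (cases rule: tensor_relationsE)
        (simp_all only: free_map_diff free_map_single map_prod_simp f.add f.scale g.add g.scale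
          tensor_relationsI)
  qed
qed

lemma tensor_flip_class: "tensor_flip (tensor_class p) = tensor_class (free_map prod.swap p)"
  unfolding tensor_flip_def
proof (rule UN_tensor_class, rule free_map_span)
  show "free_map prod.swap ` tensor_relations \<subseteq> tensor_relations"
  proof (rule image_subsetI)
    fix d :: "'b \<times> 'b \<Rightarrow>\<^sub>0 'a"
    assume "d \<in> tensor_relations"
    then show "free_map prod.swap d \<in> tensor_relations"
      by (cases rule: tensor_relationsE)
        (simp_all only: free_map_diff free_map_single swap_simp tensor_relationsI)
  qed
qed

lemma tensor_pairing_class:
  assumes "a \<in> dual_space" and "b \<in> dual_space"
  shows "tensor_pairing (tensor_class p) a b = free_eval (\<lambda>(x, y). a x * b y) p"
proof -
  let ?h = "\<lambda>(x, y). a x * b y"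
  interpret a: Vector_Spaces.linear scale "(*)" a using assms by (simp add: dual_space_def)
  interpret b: Vector_Spaces.linear scale "(*)" b using assms by (simp add: dual_space_def)
  interpret h: Vector_Spaces.linear free_scale "(*)" "free_eval ?h" by (rule linear_free_eval)
  have rel: "free_eval ?h d = 0" if "d \<in> tensor_relations" for d
    using that by (cases rule: tensor_relationsE)
      (simp_all only: free_eval_add free_eval_diff free_eval_single prod.case a.add a.scale b.add b.scale
        distrib_left distrib_right mult_1_left mult_ac diff_diff_add diff_self)
  have null: "free_eval ?h d = 0" if "d \<in> free.span tensor_relations" for d
    using h.eq_0_on_span[OF rel that] .
  have "free_eval ?h q = free_eval ?h p" if "q \<in> tensor_class p" for q
  proof -
    have "p - q \<in> free.span tensor_relations"
      using that by (simp add: tensor_class_def tensor_rel_def)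
    from null[OF this] show ?thesis by (simp only: free_eval_diff right_minus_eq)
  qed
  then have "free_eval ?h ` tensor_class p = (\<lambda>q. free_eval ?h p) ` tensor_class p"
    by (intro image_cong refl)
  moreover have "p \<in> tensor_class p"
    using equiv_class_self[OF equiv_tensor_rel] by (simp add: tensor_class_def)
  ultimately have "free_eval ?h ` tensor_class p = {free_eval ?h p}"
    by (simp only: image_constant)
  then show ?thesis by (simp add: tensor_pairing_def)
qed

end


section \<open>Bilinear forms\<close>

definition bilinear_form ::
    "('f::field \<Rightarrow> 'v::ab_group_add \<Rightarrow> 'v) \<Rightarrow> ('v \<Rightarrow> 'v \<Rightarrow> 'f) \<Rightarrow> bool" where
  "bilinear_form scale B \<longleftrightarrow>
     (\<forall>x. Vector_Spaces.linear scale (*) (\<lambda>y. B x y)) \<and>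
     (\<forall>y. Vector_Spaces.linear scale (*) (\<lambda>x. B x y))"

definition nondegenerate :: "('v::zero \<Rightarrow> 'v \<Rightarrow> 'f::zero) \<Rightarrow> bool" where
  "nondegenerate B \<longleftrightarrow>
     (\<forall>x. (\<forall>y. B x y = 0) \<longrightarrow> x = 0) \<and> (\<forall>y. (\<forall>x. B x y = 0) \<longrightarrow> y = 0)"

definition skew_symmetric_form :: "('v \<Rightarrow> 'v \<Rightarrow> 'f::uminus) \<Rightarrow> bool"
  where "skew_symmetric_form B \<longleftrightarrow> (\<forall>x y. B x y = - B y x)"

definition form_map :: "('v \<Rightarrow> 'v \<Rightarrow> 'f) \<Rightarrow> 'v \<Rightarrow> ('v \<Rightarrow> 'f)"
  where "form_map B x = (\<lambda>y. B x y)"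

context tensor_square
begin

text \<open>
  For a nondegenerate bilinear form on a finite-dimensional space, \<open>form_map B\<close> is a
  bijection onto \<open>dual_space\<close>, so \<open>inv (form_map B)\<close> is its inverse there.
\<close>

definition form_tensor :: "('b \<Rightarrow> 'b \<Rightarrow> 'a) \<Rightarrow> ('b \<times> 'b \<Rightarrow>\<^sub>0 'a) set" where
  "form_tensor B = (THE r. r \<in> tensor_space \<and>
     (\<forall>a\<in>dual_space. \<forall>b\<in>dual_space. tensor_pairing r a b = b (inv (form_map B) a)))"

end


section \<open>Dialgebras\<close>

locale dialgebra = finite_dimensional_vector_space scale Basis + tensor_square scale
  for scale :: "'f::field_char_0 \<Rightarrow> 'v::ab_group_add \<Rightarrow> 'v" (infixr \<open>*s\<close> 75)
    and Basis :: "'v set" +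
  fixes rprod :: "'v \<Rightarrow> 'v \<Rightarrow> 'v" (infixl \<open>\<rhd>\<close> 70)
    and lprod :: "'v \<Rightarrow> 'v \<Rightarrow> 'v" (infixl \<open>\<lhd>\<close> 70)
  assumes linear_rprod_right: "Vector_Spaces.linear scale scale (\<lambda>y. x \<rhd> y)"
    and linear_rprod_left: "Vector_Spaces.linear scale scale (\<lambda>x. x \<rhd> y)"
    and linear_lprod_right: "Vector_Spaces.linear scale scale (\<lambda>y. x \<lhd> y)"
    and linear_lprod_left: "Vector_Spaces.linear scale scale (\<lambda>x. x \<lhd> y)"
    and rprod_assoc: "(x \<rhd> y) \<rhd> z = x \<rhd> (y \<rhd> z)"
    and lprod_assoc: "(x \<lhd> y) \<lhd> z = x \<lhd> (y \<lhd> z)"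
    and lprod_lprod: "(x \<lhd> y) \<lhd> z = x \<lhd> (y \<rhd> z)"
    and rprod_lprod: "(x \<rhd> y) \<lhd> z = x \<rhd> (y \<lhd> z)"
    and lprod_rprod: "(x \<lhd> y) \<rhd> z = x \<rhd> (y \<rhd> z)"
begin

definition star :: "'v \<Rightarrow> 'v \<Rightarrow> 'v" (infixl \<open>\<star>\<close> 70)
  where "x \<star> y = x \<rhd> y - x \<lhd> y"

definition invariant_form :: "('v \<Rightarrow> 'v \<Rightarrow> 'f) \<Rightarrow> bool" where
  "invariant_form B \<longleftrightarrow>
     (\<forall>x y z. B (x \<rhd> y) z = B x (y \<rhd> z - y \<lhd> z)) \<and>
     (\<forall>x y z. B (x \<lhd> y) z = B x (y \<rhd> z))"

definition E_op :: "'v \<Rightarrow> ('v \<times> 'v \<Rightarrow>\<^sub>0 'f) set \<Rightarrow> ('v \<times> 'v \<Rightarrow>\<^sub>0 'f) set" where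
  "E_op x r = tensor_add (tensor_map (\<lambda>u. u \<star> x) id r) (tensor_map id (\<lambda>v. x \<lhd> v) r)"

definition F_op :: "'v \<Rightarrow> ('v \<times> 'v \<Rightarrow>\<^sub>0 'f) set \<Rightarrow> ('v \<times> 'v \<Rightarrow>\<^sub>0 'f) set" where
  "F_op x r = tensor_diff (tensor_map (\<lambda>u. u \<rhd> x) id r) (tensor_map id (\<lambda>v. x \<star> v) r)"

definition invariant_tensor :: "('v \<times> 'v \<Rightarrow>\<^sub>0 'f) set \<Rightarrow> bool"
  where "invariant_tensor r \<longleftrightarrow> (\<forall>x. E_op x r = tensor_zero \<and> F_op x r = tensor_zero)"

end

locale skew_symmetric_frobenius_dialgebra = dialgebra scale Basis rprod lprod
  for scale :: "'f::field_char_0 \<Rightarrow> 'v::ab_group_add \<Rightarrow> 'v"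
    and Basis :: "'v set"
    and rprod lprod :: "'v \<Rightarrow> 'v \<Rightarrow> 'v" +
  fixes B :: "'v \<Rightarrow> 'v \<Rightarrow> 'f"
  assumes bilinear: "bilinear_form scale B"
    and nondegenerate: "nondegenerate B"
    and skew_symmetric: "skew_symmetric_form B"
    and invariant: "invariant_form B"

end

theory Submission
  imports Defs
begin

text \<open>
  Pairings with decomposable functionals separate the points of \<open>A \<otimes> A\<close>, so skew-symmetry and
  invariance of \<open>r\<^sub>B\<close> may be tested on \<open>\<phi>\<^sub>B u \<otimes> \<phi>\<^sub>B v\<close>. There \<open>\<langle>r\<^sub>B, \<phi>\<^sub>B u \<otimes> b\<rangle> = b u\<close>, hence
  \<open>r\<^sub>B\<close> is skew-symmetric iff \<open>B\<close> is, and then also \<open>\<langle>r\<^sub>B, a \<otimes> \<phi>\<^sub>B v\<rangle> = - a v\<close>. With these two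
  formulas \<open>E(x) r\<^sub>B = 0\<close> and \<open>F(x) r\<^sub>B = 0\<close> become \<open>B u (v \<star> x) = B v (x \<lhd> u)\<close> and
  \<open>B u (v \<rhd> x) = - B v (x \<star> u)\<close>, which for skew-symmetric \<open>B\<close> amount to invariance of \<open>B\<close>.
\<close>

section \<open>Evaluation on the free vector space\<close>

lemma free_eval_free_map: "free_eval h (free_map k p) = free_eval (h \<circ> k) p"
proof -
  interpret h: Vector_Spaces.linear free_scale "(*)" "free_eval h" by (rule linear_free_eval)
  show ?thesis by (simp add: free_map_def h.sum) (simp add: free_eval_def)
qed

lemma free_eval_uminus: "free_eval h (- p) = - free_eval h p"
  using free_eval_add[of h p "- p"] by (simp add: free_eval_def eq_neg_iff_add_eq_0 add.commute)

lemma free_eval_zero: "free_eval h 0 = 0"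
  by (simp add: free_eval_def)

section \<open>Pairings of transformed tensors\<close>

context tensor_square
begin

lemma tensor_spaceE:
  assumes "r \<in> tensor_space"
  obtains p where "r = tensor_class p"
  using assms unfolding tensor_space_def tensor_class_def by (auto elim: quotientE)

lemma tensor_class_in_space [simp]: "tensor_class p \<in> tensor_space"
  unfolding tensor_space_def tensor_class_def by (rule quotientI) simp

lemma dual_space_comp:
  assumes "Vector_Spaces.linear scale scale f" and "a \<in> dual_space"
  shows "a \<circ> f \<in> dual_space"
  using assms Vector_Spaces.linear_compose unfolding dual_space_def by blast

text \<open>The transpose rule: on representatives, evaluating after \<open>free_map\<close> is
  evaluating the composed function. It moves the operators in \<open>E_op\<close> and
  \<open>F_op\<close> from the tensor onto the functionals.\<close>

lemma tensor_pairing_map: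
  assumes "Vector_Spaces.linear scale scale f" and "Vector_Spaces.linear scale scale g"
    and "a \<in> dual_space" and "b \<in> dual_space" and "r \<in> tensor_space"
  shows "tensor_pairing (tensor_map f g r) a b = tensor_pairing r (a \<circ> f) (b \<circ> g)"
  using assms(5)
  by (rule tensor_spaceE)
    (simp add: tensor_map_class tensor_pairing_class dual_space_comp assms free_eval_free_map,
      simp add: case_prod_beta' comp_def)

lemma tensor_pairing_flip:
  assumes "a \<in> dual_space" and "b \<in> dual_space" and "r \<in> tensor_space"
  shows "tensor_pairing (tensor_flip r) a b = tensor_pairing r b a"
  using assms(3)
  by (rule tensor_spaceE)
    (simp add: tensor_flip_class tensor_pairing_class assms free_eval_free_map
      case_prod_beta' comp_def mult.commute)

lemma tensor_pairing_uminus: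
  assumes "a \<in> dual_space" and "b \<in> dual_space" and "r \<in> tensor_space"
  shows "tensor_pairing (tensor_uminus r) a b = - tensor_pairing r a b"
  using assms(3)
  by (rule tensor_spaceE)
    (simp add: tensor_uminus_class tensor_pairing_class assms free_eval_uminus)

lemma tensor_pairing_add:
  assumes "a \<in> dual_space" and "b \<in> dual_space" and "r \<in> tensor_space" and "s \<in> tensor_space"
  shows "tensor_pairing (tensor_add r s) a b = tensor_pairing r a b + tensor_pairing s a b"
  using assms(3,4)
  by (elim tensor_spaceE)
    (simp add: tensor_add_class tensor_pairing_class assms free_eval_add)

lemma tensor_pairing_diff:
  assumes "a \<in> dual_space" and "b \<in> dual_space" and "r \<in> tensor_space" and "s \<in> tensor_space"
  shows "tensor_pairing (tensor_diff r s) a b = tensor_pairing r a b - tensor_pairing s a b"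
  using assms(3,4)
  by (elim tensor_spaceE)
    (simp add: tensor_diff_class tensor_pairing_class assms free_eval_diff)

lemma tensor_pairing_zero:
  assumes "a \<in> dual_space" and "b \<in> dual_space"
  shows "tensor_pairing tensor_zero a b = 0"
  by (simp add: tensor_zero_def tensor_pairing_class assms free_eval_zero)

lemma tensor_space_closed:
  shows "tensor_zero \<in> tensor_space"
    and "r \<in> tensor_space \<Longrightarrow> tensor_flip r \<in> tensor_space"
    and "r \<in> tensor_space \<Longrightarrow> tensor_uminus r \<in> tensor_space"
    and "r \<in> tensor_space \<Longrightarrow> s \<in> tensor_space \<Longrightarrow> tensor_add r s \<in> tensor_space"
    and "r \<in> tensor_space \<Longrightarrow> s \<in> tensor_space \<Longrightarrow> tensor_diff r s \<in> tensor_space"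
    and "Vector_Spaces.linear scale scale f \<Longrightarrow> Vector_Spaces.linear scale scale g
      \<Longrightarrow> r \<in> tensor_space \<Longrightarrow> tensor_map f g r \<in> tensor_space"
  by (auto simp: tensor_zero_def tensor_flip_class tensor_uminus_class tensor_add_class
      tensor_diff_class tensor_map_class elim!: tensor_spaceE)

section \<open>Bilinearity modulo the relations, with arbitrary coefficients and finite sums\<close>

lemma single_scale_left:
  "Poly_Mapping.single (c *s x, y) d - Poly_Mapping.single (x, y) (c * d)
     \<in> module.span free_scale tensor_relations"
proof -
  have "free_scale d (Poly_Mapping.single (c *s x, y) 1 - Poly_Mapping.single (x, y) c)
      \<in> free.span tensor_relations"
    by (intro free.span_scale free.span_base tensor_relationsI)
  also have "free_scale d (Poly_Mapping.single (c *s x, y) 1 - Poly_Mapping.single (x, y) c) =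
      Poly_Mapping.single (c *s x, y) d - Poly_Mapping.single (x, y) (c * d)"
    by (rule poly_mapping_eqI) (simp add: lookup_minus lookup_single when_def algebra_simps)
  finally show ?thesis .
qed

lemma single_scale_right:
  "Poly_Mapping.single (x, c *s y) d - Poly_Mapping.single (x, y) (c * d)
     \<in> module.span free_scale tensor_relations"
proof -
  have "free_scale d (Poly_Mapping.single (x, c *s y) 1 - Poly_Mapping.single (x, y) c)
      \<in> free.span tensor_relations"
    by (intro free.span_scale free.span_base tensor_relationsI)
  also have "free_scale d (Poly_Mapping.single (x, c *s y) 1 - Poly_Mapping.single (x, y) c) =
      Poly_Mapping.single (x, c *s y) d - Poly_Mapping.single (x, y) (c * d)"
    by (rule poly_mapping_eqI) (simp add: lookup_minus lookup_single when_def algebra_simps)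
  finally show ?thesis .
qed

lemma single_add_left:
  "Poly_Mapping.single (x + y, z) d - Poly_Mapping.single (x, z) d - Poly_Mapping.single (y, z) d
     \<in> module.span free_scale tensor_relations"
proof -
  have "free_scale d (Poly_Mapping.single (x + y, z) 1 - Poly_Mapping.single (x, z) 1
      - Poly_Mapping.single (y, z) 1) \<in> free.span tensor_relations"
    by (intro free.span_scale free.span_base tensor_relationsI)
  also have "free_scale d (Poly_Mapping.single (x + y, z) 1 - Poly_Mapping.single (x, z) 1
      - Poly_Mapping.single (y, z) 1) = Poly_Mapping.single (x + y, z) d
      - Poly_Mapping.single (x, z) d - Poly_Mapping.single (y, z) d"
    by (rule poly_mapping_eqI) (simp add: lookup_minus lookup_single when_def algebra_simps)
  finally show ?thesis .
qed

lemma single_add_right: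
  "Poly_Mapping.single (x, y + z) d - Poly_Mapping.single (x, y) d - Poly_Mapping.single (x, z) d
     \<in> module.span free_scale tensor_relations"
proof -
  have "free_scale d (Poly_Mapping.single (x, y + z) 1 - Poly_Mapping.single (x, y) 1
      - Poly_Mapping.single (x, z) 1) \<in> free.span tensor_relations"
    by (intro free.span_scale free.span_base tensor_relationsI)
  also have "free_scale d (Poly_Mapping.single (x, y + z) 1 - Poly_Mapping.single (x, y) 1
      - Poly_Mapping.single (x, z) 1) = Poly_Mapping.single (x, y + z) d
      - Poly_Mapping.single (x, y) d - Poly_Mapping.single (x, z) d"
    by (rule poly_mapping_eqI) (simp add: lookup_minus lookup_single when_def algebra_simps)
  finally show ?thesis .
qed

lemma single_sum_left:
  assumes "finite S"
  shows "Poly_Mapping.single (\<Sum>e\<in>S. c e *s e, y) d - (\<Sum>e\<in>S. Poly_Mapping.single (e, y) (c e * d))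
     \<in> module.span free_scale tensor_relations"
  using assms
proof induction
  case empty
  \<comment> \<open>The scaling relation with \<open>c = 0\<close> puts
    \<open>Poly_Mapping.single (0, y) d\<close> into the span, which is the claim for the empty
    sum.\<close>
  show ?case using single_scale_left[of 0 0 y d] by simp
next
  case (insert e S)
  \<comment> \<open>Split off one summand, pull out its scalar, and treat the rest by induction; the
    three memberships telescope.\<close>
  from free.span_add[OF free.span_add[OF single_add_left single_scale_left] insert.IH]
  have "Poly_Mapping.single (c e *s e + (\<Sum>e\<in>S. c e *s e), y) d
      - Poly_Mapping.single (c e *s e, y) d - Poly_Mapping.single (\<Sum>e\<in>S. c e *s e, y) d
      + (Poly_Mapping.single (c e *s e, y) d - Poly_Mapping.single (e, y) (c e * d))
      + (Poly_Mapping.single (\<Sum>e\<in>S. c e *s e, y) d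
          - (\<Sum>e\<in>S. Poly_Mapping.single (e, y) (c e * d))) \<in> free.span tensor_relations" .
  then show ?case using insert.hyps by (simp add: algebra_simps)
qed

lemma single_sum_right:
  assumes "finite S"
  shows "Poly_Mapping.single (x, \<Sum>e\<in>S. c e *s e) d - (\<Sum>e\<in>S. Poly_Mapping.single (x, e) (c e * d))
     \<in> module.span free_scale tensor_relations"
  using assms
proof induction
  case empty
  show ?case using single_scale_right[of x 0 0 d] by simp
next
  case (insert e S)
  from free.span_add[OF free.span_add[OF single_add_right single_scale_right] insert.IH]
  have "Poly_Mapping.single (x, c e *s e + (\<Sum>e\<in>S. c e *s e)) d
      - Poly_Mapping.single (x, c e *s e) d - Poly_Mapping.single (x, \<Sum>e\<in>S. c e *s e) d
      + (Poly_Mapping.single (x, c e *s e) d - Poly_Mapping.single (x, e) (c e * d))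
      + (Poly_Mapping.single (x, \<Sum>e\<in>S. c e *s e) d
          - (\<Sum>e\<in>S. Poly_Mapping.single (x, e) (c e * d))) \<in> free.span tensor_relations" .
  then show ?case using insert.hyps by (simp add: algebra_simps)
qed

end

section \<open>Coordinates in a finite basis; functionals separate tensors\<close>

locale finite_dimensional_tensor_square =
  finite_dimensional_vector_space scale Basis + tensor_square scale
  for scale :: "'a::field \<Rightarrow> 'b::ab_group_add \<Rightarrow> 'b" (infixr \<open>*s\<close> 75)
    and Basis :: "'b set"
begin

abbreviation coord :: "'b \<Rightarrow> 'b \<Rightarrow> 'a"
  where "coord e x \<equiv> representation Basis x e"

lemma sum_coord: "(\<Sum>e\<in>Basis. coord e x *s e) = x"
  by (rule sum_representation_eq) (simp_all add: independent_Basis span_Basis finite_Basis)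

lemma coord_in_dual_space [simp]: "coord e \<in> dual_space"
  unfolding dual_space_def mem_Collect_eq
  by (rule linear_representation) (simp_all add: independent_Basis span_Basis)

text \<open>Expand \<open>x\<close> in the basis, then \<open>y\<close> in each resulting term, and
  add the two memberships in the span.\<close>

lemma single_eq_sum_coord:
  "Poly_Mapping.single (x, y) d
     - (\<Sum>e\<in>Basis. \<Sum>f\<in>Basis. Poly_Mapping.single (e, f) (d * (coord e x * coord f y)))
     \<in> module.span free_scale tensor_relations"
proof -
  have 1: "Poly_Mapping.single (x, y) d - (\<Sum>e\<in>Basis. Poly_Mapping.single (e, y) (coord e x * d))
      \<in> free.span tensor_relations"
    using single_sum_left[OF finite_Basis, of "\<lambda>e. coord e x" y d] by (simp add: sum_coord)
  have "Poly_Mapping.single (e, y) (coord e x * d)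
      - (\<Sum>f\<in>Basis. Poly_Mapping.single (e, f) (d * (coord e x * coord f y)))
      \<in> free.span tensor_relations" for e
    using single_sum_right[OF finite_Basis, of e "\<lambda>f. coord f y" "coord e x * d"]
    by (simp add: sum_coord mult_ac)
  then have "(\<Sum>e\<in>Basis. Poly_Mapping.single (e, y) (coord e x * d)
      - (\<Sum>f\<in>Basis. Poly_Mapping.single (e, f) (d * (coord e x * coord f y))))
      \<in> free.span tensor_relations"
    by (rule free.span_sum)
  from free.span_add[OF 1 this] show ?thesis by (simp add: sum_subtractf)
qed

text \<open>A normal form for tensors. The map \<open>?N\<close> is additive, so writing
  \<open>p\<close> as the finite sum over its support reduces the claim, by induction, to a single
  generator.\<close>

lemma tensor_class_coord:
  "tensor_class p = tensor_class (\<Sum>e\<in>Basis. \<Sum>f\<in>Basis.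
     Poly_Mapping.single (e, f) (tensor_pairing (tensor_class p) (coord e) (coord f)))"
proof -
  let ?N = "\<lambda>p. \<Sum>e\<in>Basis. \<Sum>f\<in>Basis.
    Poly_Mapping.single (e, f) (free_eval (\<lambda>(x, y). coord e x * coord f y) p)"
  have add: "?N (p + q) = ?N p + ?N q" for p q
    by (simp add: free_eval_add single_add sum.distrib)
  have zero: "?N 0 = 0" by (simp add: free_eval_zero)
  have *: "(\<Sum>k\<in>K. Poly_Mapping.single k (c k)) - ?N (\<Sum>k\<in>K. Poly_Mapping.single k (c k))
      \<in> free.span tensor_relations" if "finite K" for K :: "('b \<times> 'b) set" and c
    using that
  proof induction
    case empty
    then show ?case by (simp add: free_eval_zero free.span_zero)
  next
    case (insert k K)
    obtain x y where k: "k = (x, y)" by (cases k)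
    from free.span_add[OF single_eq_sum_coord[of x y "c k"] insert.IH]
    show ?case using insert.hyps by (simp add: k add) (simp add: algebra_simps)
  qed
  have "p = (\<Sum>k\<in>Poly_Mapping.keys p. Poly_Mapping.single k (Poly_Mapping.lookup p k))"
    by (rule poly_mapping_eqI) (simp add: lookup_sum lookup_single when_def in_keys_iff)
  with *[of "Poly_Mapping.keys p" "Poly_Mapping.lookup p"]
  have "p - ?N p \<in> free.span tensor_relations" by simp
  then show ?thesis by (simp add: tensor_class_eq_iff tensor_pairing_class)
qed

text \<open>The pairings with coordinate functionals are the coefficients of the normal form in
  \<open>tensor_class_coord\<close>, so equal pairings force equal normal forms.\<close>

lemma tensor_eqI:
  assumes "r \<in> tensor_space" and "s \<in> tensor_space"
    and "\<And>a b. a \<in> dual_space \<Longrightarrow> b \<in> dual_space \<Longrightarrow> tensor_pairing r a b = tensor_pairing s a b"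
  shows "r = s"
  using assms(1,2)
proof (elim tensor_spaceE)
  fix p q
  assume rs: "r = tensor_class p" "s = tensor_class q"
  have "tensor_pairing (tensor_class p) (coord e) (coord f) =
      tensor_pairing (tensor_class q) (coord e) (coord f)" for e f
    using assms(3) by (simp add: rs)
  then have "(\<Sum>e\<in>Basis. \<Sum>f\<in>Basis. Poly_Mapping.single (e, f)
        (tensor_pairing (tensor_class p) (coord e) (coord f))) =
      (\<Sum>e\<in>Basis. \<Sum>f\<in>Basis. Poly_Mapping.single (e, f)
        (tensor_pairing (tensor_class q) (coord e) (coord f)))"
    by simp
  with tensor_class_coord[of p] tensor_class_coord[of q] show ?thesis
    by (simp only: rs)
qed

lemma skew_symmetric_tensor_iff:
  assumes "r \<in> tensor_space"
  shows "skew_symmetric_tensor r \<longleftrightarrow>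
    (\<forall>a\<in>dual_space. \<forall>b\<in>dual_space. tensor_pairing r b a = - tensor_pairing r a b)"
proof -
  have "skew_symmetric_tensor r \<longleftrightarrow> (\<forall>a\<in>dual_space. \<forall>b\<in>dual_space.
      tensor_pairing (tensor_flip r) a b = tensor_pairing (tensor_uminus r) a b)"
    unfolding skew_symmetric_tensor_def
    using tensor_eqI[OF tensor_space_closed(2,3)[OF assms]] by auto
  then show ?thesis
    by (simp add: assms tensor_pairing_flip tensor_pairing_uminus cong: ball_cong)
qed

lemma dual_space_eq_on_Basis:
  assumes "a \<in> dual_space" and "b \<in> dual_space" and "\<And>e. e \<in> Basis \<Longrightarrow> a e = b e"
  shows "a = b"
proof
  fix x
  interpret a: Vector_Spaces.linear scale "(*)" a using assms(1) by (simp add: dual_space_def)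
  interpret b: Vector_Spaces.linear scale "(*)" b using assms(2) by (simp add: dual_space_def)
  have "a (\<Sum>e\<in>Basis. coord e x *s e) = b (\<Sum>e\<in>Basis. coord e x *s e)"
    by (simp add: a.sum b.sum a.scale b.scale assms(3))
  then show "a x = b x" by (simp add: sum_coord)
qed

section \<open>Nondegenerate forms: the isomorphism onto the dual space and the inverse
  tensor\<close>

context
  fixes B :: "'b \<Rightarrow> 'b \<Rightarrow> 'a"
  assumes bilinear: "bilinear_form scale B" and nondegenerate: "nondegenerate B"
begin

lemma form_map_in_dual_space: "form_map B x \<in> dual_space"
  using bilinear by (simp add: bilinear_form_def form_map_def dual_space_def)

lemma inj_form_map: "inj (form_map B)"
proof (rule injI)
  fix x y
  assume "form_map B x = form_map B y"
  then have "B (x - y) z = 0" for z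
  proof -
    interpret Bz: Vector_Spaces.linear scale "(*)" "\<lambda>x. B x z"
      using bilinear by (simp add: bilinear_form_def)
    show "B (x - y) z = 0"
      using \<open>form_map B x = form_map B y\<close> by (simp add: Bz.diff form_map_def fun_eq_iff)
  qed
  with nondegenerate have "x - y = 0" unfolding nondegenerate_def by blast
  then show "x = y" by simp
qed

lemma dual_space_eq_form_map:
  assumes "a \<in> dual_space"
  obtains x where "a = form_map B x"
proof -
  \<comment> \<open>\<open>T\<close> is \<open>form_map B\<close> followed by the identification of
    a functional with the vector of its values on the basis. As an endomorphism of a
    finite-dimensional space it is onto once it is injective.\<close>
  define T where "T x = (\<Sum>e\<in>Basis. B x e *s e)" for x
  have coord_sum: "coord e (\<Sum>e\<in>Basis. c e *s e) = c e" if "e \<in> Basis" for c e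
  proof -
    interpret coord: Vector_Spaces.linear scale "(*)" "coord e"
      using coord_in_dual_space by (simp add: dual_space_def)
    show ?thesis
      using that by (simp add: coord.sum coord.scale representation_basis independent_Basis
          finite_Basis if_distrib[of "(*) _"] cong: if_cong)
  qed
  have "Vector_Spaces.linear scale scale T"
    using bilinear by (simp add: bilinear_form_def Vector_Spaces.linear_iff T_def scale_left_distrib
        sum.distrib scale_sum_right)
  moreover have "inj T"
  proof (rule injI)
    fix x y
    assume "T x = T y"
    then have "form_map B x e = form_map B y e" if "e \<in> Basis" for e
      using coord_sum[OF that, of "B x"] coord_sum[OF that, of "B y"]
      by (simp add: T_def form_map_def)
    then have "form_map B x = form_map B y"
      by (rule dual_space_eq_on_Basis[OF form_map_in_dual_space form_map_in_dual_space])
    then show "x = y" by (rule injD[OF inj_form_map])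
  qed
  ultimately have "surj T" by (rule linear_inj_imp_surj)
  then obtain x where x: "T x = (\<Sum>e\<in>Basis. a e *s e)" by (metis surjD)
  have "a e = form_map B x e" if "e \<in> Basis" for e
    using coord_sum[OF that, of "B x"] coord_sum[OF that, of a] x
    by (simp add: T_def form_map_def)
  then have "a = form_map B x"
    by (rule dual_space_eq_on_Basis[OF assms form_map_in_dual_space])
  then show ?thesis by (rule that)
qed

text \<open>This justifies the definite description in \<open>form_tensor\<close>: uniqueness is
  \<open>tensor_eqI\<close>, and existence is shown by an explicit tensor.\<close>

lemma form_tensor_characterization:
  "form_tensor B \<in> tensor_space \<and>
   (\<forall>a\<in>dual_space. \<forall>b\<in>dual_space.
      tensor_pairing (form_tensor B) a b = b (inv (form_map B) a))"
  unfolding form_tensor_def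
proof (rule theI')
  have "\<exists>x. form_map B x = coord e" for e
    by (rule dual_space_eq_form_map[OF coord_in_dual_space]) (rule exI, rule sym)
  then have "\<exists>d. \<forall>e. form_map B (d e) = coord e" by (intro choice allI)
  then obtain d where d: "form_map B (d e) = coord e" for e by blast
  \<comment> \<open>The canonical element \<Sum> e \<otimes> \<open>coord e\<close>, with the
    inverse of \<open>form_map B\<close> applied to the second factor.\<close>
  define r where "r = tensor_class (\<Sum>e\<in>Basis. Poly_Mapping.single (e, d e) 1)"
  have "tensor_pairing r a b = b (inv (form_map B) a)" if a: "a \<in> dual_space" and b: "b \<in> dual_space" for a b
  proof -
    let ?h = "\<lambda>(x, y). a x * b y"
    interpret h: Vector_Spaces.linear free_scale "(*)" "free_eval ?h" by (rule linear_free_eval)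
    interpret a: Vector_Spaces.linear scale "(*)" a using a by (simp add: dual_space_def)
    interpret b: Vector_Spaces.linear scale "(*)" b using b by (simp add: dual_space_def)
    \<comment> \<open>Since \<open>a\<close> is the combination of the \<open>coord e\<close> with
      coefficients \<open>a e\<close>, its preimage is the same combination of the
      \<open>d e\<close>; applying \<open>b\<close> to it yields the pairing with
      \<open>r\<close>.\<close>
    have "form_map B (\<Sum>e\<in>S. a e *s d e) y = (\<Sum>e\<in>S. a e * coord e y)" for S y
    proof -
      interpret By: Vector_Spaces.linear scale "(*)" "\<lambda>x. B x y"
        using bilinear by (simp add: bilinear_form_def)
      show ?thesis using d by (simp add: form_map_def By.sum By.scale fun_eq_iff)
    qed
    moreover have "(\<Sum>e\<in>Basis. a e * coord e y) = a y" for y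
      using arg_cong[OF sum_coord[of y], of a] by (simp add: a.sum a.scale mult.commute)
    ultimately have "form_map B (\<Sum>e\<in>Basis. a e *s d e) = a" by auto
    then have "inv (form_map B) a = (\<Sum>e\<in>Basis. a e *s d e)"
      using inv_f_f[OF inj_form_map] by metis
    then show ?thesis
      by (simp add: r_def tensor_pairing_class a b h.sum b.sum b.scale)
  qed
  then show "\<exists>!r. r \<in> tensor_space \<and>
     (\<forall>a\<in>dual_space. \<forall>b\<in>dual_space. tensor_pairing r a b = b (inv (form_map B) a))"
    by (intro ex1I[of _ r] conjI tensor_eqI) (simp_all add: r_def)
qed

lemma form_tensor_in_space: "form_tensor B \<in> tensor_space"
  using form_tensor_characterization by blast

lemma form_tensor_pairing:
  assumes "b \<in> dual_space"
  shows "tensor_pairing (form_tensor B) (form_map B x) b = b x"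
  using form_tensor_characterization assms
  by (simp add: form_map_in_dual_space inv_f_f[OF inj_form_map])

text \<open>\<open>form_map B\<close> is onto the dual space, so tests on functionals become
  identities between values of \<open>B\<close>.\<close>

lemma ball_dual_space_iff: "(\<forall>a\<in>dual_space. P a) \<longleftrightarrow> (\<forall>x. P (form_map B x))"
proof
  assume P: "\<forall>x. P (form_map B x)"
  show "\<forall>a\<in>dual_space. P a"
  proof
    fix a
    assume "a \<in> dual_space"
    then obtain x where "a = form_map B x" by (rule dual_space_eq_form_map)
    with P show "P a" by simp
  qed
qed (simp add: form_map_in_dual_space)

text \<open>The tensor pairs with \<open>form_map B u\<close> and \<open>form_map B v\<close> to
  \<open>B v u\<close>, so exchanging the functionals exchanges the arguments of
  \<open>B\<close>.\<close>

lemma skew_symmetric_form_tensor_iff: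
  "skew_symmetric_tensor (form_tensor B) \<longleftrightarrow> skew_symmetric_form B"
  unfolding skew_symmetric_tensor_iff[OF form_tensor_in_space] ball_dual_space_iff
  by (simp add: form_tensor_pairing form_map_in_dual_space)
    (simp add: form_map_def skew_symmetric_form_def)

text \<open>Skew-symmetry of the tensor carries \<open>form_tensor_pairing\<close> over to the
  second slot at the cost of a sign. This serves the terms of \<open>E_op\<close> and
  \<open>F_op\<close> that act on the first factor.\<close>

lemma form_tensor_pairing_right:
  assumes "skew_symmetric_form B" and "a \<in> dual_space"
  shows "tensor_pairing (form_tensor B) a (form_map B x) = - a x"
proof -
  have "tensor_pairing (form_tensor B) a (form_map B x) =
      - tensor_pairing (form_tensor B) (form_map B x) a"
    using assms form_map_in_dual_space
    unfolding skew_symmetric_form_tensor_iff[symmetric]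
      skew_symmetric_tensor_iff[OF form_tensor_in_space] by blast
  then show ?thesis using assms(2) by (simp add: form_tensor_pairing)
qed

lemma tensor_eq_iff_form_map:
  assumes "r \<in> tensor_space" and "s \<in> tensor_space"
  shows "r = s \<longleftrightarrow> (\<forall>u v. tensor_pairing r (form_map B u) (form_map B v) =
    tensor_pairing s (form_map B u) (form_map B v))"
proof
  assume *: "\<forall>u v. tensor_pairing r (form_map B u) (form_map B v) =
    tensor_pairing s (form_map B u) (form_map B v)"
  have "\<forall>a\<in>dual_space. \<forall>b\<in>dual_space. tensor_pairing r a b = tensor_pairing s a b"
    unfolding ball_dual_space_iff by (rule *)
  then show "r = s" by (intro tensor_eqI assms) simp
qed simp

end

end

section \<open>Invariance of the tensor and of the form on a dialgebra\<close>

sublocale dialgebra \<subseteq> finite_dimensional_tensor_square scale Basis ..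

context dialgebra
begin

lemma linear_star:
  shows "Vector_Spaces.linear scale scale (\<lambda>u. u \<star> x)"
    and "Vector_Spaces.linear scale scale (\<lambda>v. x \<star> v)"
  using linear_rprod_left linear_rprod_right linear_lprod_left linear_lprod_right
  by (auto simp: star_def Vector_Spaces.linear_iff scale_right_diff_distrib)

context
  fixes B :: "'v \<Rightarrow> 'v \<Rightarrow> 'f"
  assumes bilinear: "bilinear_form scale B" and nondegenerate: "nondegenerate B"
    and skew: "skew_symmetric_form B"
begin

lemmas linear_ops = linear_star linear_rprod_left linear_rprod_right
  linear_lprod_left linear_lprod_right linear_id

text \<open>These rules push a pairing through the operators down to \<open>form_tensor B\<close>.
  The slot that is not acted on keeps its functional \<open>form_map B u\<close>, so one of the two
  evaluation formulas applies.\<close>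

lemmas pairing_simps =
  tensor_pairing_zero tensor_pairing_add tensor_pairing_diff tensor_pairing_map
  form_tensor_pairing[OF bilinear nondegenerate]
  form_tensor_pairing_right[OF bilinear nondegenerate skew]
  form_tensor_in_space[OF bilinear nondegenerate] form_map_in_dual_space[OF bilinear nondegenerate]
  dual_space_comp tensor_space_closed linear_ops

text \<open>Against \<open>form_map B u\<close> and \<open>form_map B v\<close>, the term acting on
  the first factor pairs to \<open>- B u (v \<star> x)\<close> and the other one to
  \<open>B v (x \<lhd> u)\<close>.\<close>

lemma E_op_form_tensor_iff:
  "E_op x (form_tensor B) = tensor_zero \<longleftrightarrow> (\<forall>u v. B v (x \<lhd> u) = B u (v \<star> x))"
  unfolding E_op_def
  by (subst tensor_eq_iff_form_map[OF bilinear nondegenerate])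
    (simp_all add: pairing_simps, simp add: form_map_def)

text \<open>By the same test the two terms give \<open>- B u (v \<rhd> x)\<close> and
  \<open>B v (x \<star> u)\<close>, and \<open>F_op\<close> is their difference.\<close>

lemma F_op_form_tensor_iff:
  "F_op x (form_tensor B) = tensor_zero \<longleftrightarrow> (\<forall>u v. - B u (v \<rhd> x) = B v (x \<star> u))"
  unfolding F_op_def
  by (subst tensor_eq_iff_form_map[OF bilinear nondegenerate])
    (simp_all add: pairing_simps, simp add: form_map_def)

lemma invariant_form_tensor_iff:
  "invariant_tensor (form_tensor B) \<longleftrightarrow> invariant_form B"
proof -
  have sk: "B x y = - B y x" for x y
    using skew unfolding skew_symmetric_form_def by blast
  have diff: "B x (y - z) = B x y - B x z" for x y z
  proof -
    interpret Bx: Vector_Spaces.linear scale "(*)" "B x"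
      using bilinear by (simp add: bilinear_form_def)
    show ?thesis by (rule Bx.diff)
  qed
  \<comment> \<open>Skew-symmetry turns the left-hand side into \<open>B (v \<rhd> x) u\<close>, so
    the condition from \<open>F_op\<close> is by itself the first invariance identity.\<close>
  have F: "- B u (v \<rhd> x) = B v (x \<star> u) \<longleftrightarrow> B (v \<rhd> x) u = B v (x \<rhd> u - x \<lhd> u)" for u v x
    using sk[of u "v \<rhd> x"] by (simp add: star_def)
  \<comment> \<open>Expand \<open>v \<star> x\<close> and use the assumption to replace
    \<open>B u (v \<rhd> x)\<close> by \<open>B v (x \<lhd> u) - B v (x \<rhd> u)\<close>. The terms
    \<open>B v (x \<lhd> u)\<close> cancel, and \<open>- B u (v \<lhd> x)\<close> is
    \<open>B (v \<lhd> x) u\<close>.\<close>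
  have E: "B v (x \<lhd> u) = B u (v \<star> x) \<longleftrightarrow> B (v \<lhd> x) u = B v (x \<rhd> u)"
    if "- B u (v \<rhd> x) = B v (x \<star> u)" for u v x
    using that sk[of u "v \<lhd> x"] by (auto simp: star_def diff algebra_simps)
  \<comment> \<open>By \<open>F\<close>, either side yields the condition from \<open>F_op\<close>
    for all \<open>u\<close> and \<open>v\<close>, which is the premise of \<open>E\<close>.\<close>
  have "(\<forall>u v. B v (x \<lhd> u) = B u (v \<star> x)) \<and> (\<forall>u v. - B u (v \<rhd> x) = B v (x \<star> u)) \<longleftrightarrow>
      (\<forall>u v. B (v \<rhd> x) u = B v (x \<rhd> u - x \<lhd> u)) \<and> (\<forall>u v. B (v \<lhd> x) u = B v (x \<rhd> u))" for x
    using E[where x = x] F[where x = x] by blast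
  then show ?thesis
    unfolding invariant_tensor_def invariant_form_def E_op_form_tensor_iff F_op_form_tensor_iff
    by blast
qed

end

end

theorem proposition2p29:
  fixes scale :: "'f::field_char_0 \<Rightarrow> 'v::ab_group_add \<Rightarrow> 'v"
    and Basis :: "'v set"
    and rprod lprod :: "'v \<Rightarrow> 'v \<Rightarrow> 'v"
    and B :: "'v \<Rightarrow> 'v \<Rightarrow> 'f"
  assumes "dialgebra scale Basis rprod lprod"
    and "bilinear_form scale B"
    and "nondegenerate B"
  shows "skew_symmetric_frobenius_dialgebra scale Basis rprod lprod B \<longleftrightarrow>
    tensor_square.skew_symmetric_tensor scale (tensor_square.form_tensor scale B) \<and>
    dialgebra.invariant_tensor scale rprod lprod (tensor_square.form_tensor scale B)"
proof -
  interpret dialgebra scale Basis rprod lprod by fact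
  have "skew_symmetric_frobenius_dialgebra scale Basis rprod lprod B \<longleftrightarrow>
      skew_symmetric_form B \<and> invariant_form B"
    using assms by (auto simp: skew_symmetric_frobenius_dialgebra_def
        skew_symmetric_frobenius_dialgebra_axioms_def)
  \<comment> \<open>The equivalence for invariance presupposes that \<open>B\<close> is
    skew-symmetric; each side of the claim provides this, the right one through the equivalence for
    skew-symmetry.\<close>
  then show ?thesis
    using skew_symmetric_form_tensor_iff[OF assms(2,3)] invariant_form_tensor_iff[OF assms(2,3)]
    by blast
qed

end
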